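(* Let $f\in\Gamma_0(\mathbb{R}^n)$ and $r>0$. Then $f=e_rg$ for some $g\in\Gamma_0(\mathbb{R}^n)$ if and only if $f^*$ is strongly convex with modulus $1/r$.
   Context: $\Gamma_0(\mathbb{R}^n)$ is the set of proper, convex, lower semicontinuous functions $f:\mathbb{R}^n\to\mathbb{R}\cup\{\infty\}$. $\|\cdot\|$ is the Euclidean norm. The Moreau envelope is $e_rg(x)=\inf_{y\in\mathbb{R}^n}\{g(y)+\frac r2\|y-x\|^2\}$, and the Fenchel conjugate is $f^*(x^* )=\sup_{x\in\mathbb{R}^n}[\langle x^*,x\rangle-f(x)]$. A function $\varphi\in\Gamma_0(\mathbb{R}^n)$ is strongly convex with modulus $\sigma>0$ if $\varphi-\frac\sigma2\|\cdot\|^2$ is convex. *)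

theory Defs
  imports "HOL-Analysis.Analysis"
begin

text \<open>
  Functions into \<open>\<real> \<union> {\<infinity>}\<close> are rendered as \<^typ>\<open>ereal\<close>-valued functions; the value \<open>-\<infinity>\<close> is
  excluded by properness.
\<close>

definition proper_fun :: "('a \<Rightarrow> ereal) \<Rightarrow> bool" where
  "proper_fun f \<longleftrightarrow> (\<forall>x. f x \<noteq> -\<infinity>) \<and> (\<exists>x. f x \<noteq> \<infinity>)"

text \<open>
  In \<^typ>\<open>ereal\<close> we have \<open>0 * \<infinity> = 0\<close> and \<open>-\<infinity> + \<infinity> = \<infinity>\<close>, so the inequality is trivial
  for \<open>u = 0\<close> or \<open>v = 0\<close>, and it is vacuous for \<open>u, v > 0\<close> as soon as \<open>f x = \<infinity>\<close> or \<open>f y = \<infinity>\<close>.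
\<close>

definition convex_fun :: "('a::real_vector \<Rightarrow> ereal) \<Rightarrow> bool" where
  "convex_fun f \<longleftrightarrow>
     (\<forall>x y u v. 0 \<le> u \<longrightarrow> 0 \<le> v \<longrightarrow> u + v = 1 \<longrightarrow>
        f (u *\<^sub>R x + v *\<^sub>R y) \<le> ereal u * f x + ereal v * f y)"

definition lsc_fun :: "('a::topological_space \<Rightarrow> ereal) \<Rightarrow> bool" where
  "lsc_fun f \<longleftrightarrow> (\<forall>x. f x \<le> Liminf (at x) f)"

definition Gamma0 :: "('a::real_normed_vector \<Rightarrow> ereal) set" where
  "Gamma0 = {f. proper_fun f \<and> convex_fun f \<and> lsc_fun f}"

definition moreau_envelope :: "real \<Rightarrow> ('a::real_normed_vector \<Rightarrow> ereal) \<Rightarrow> 'a \<Rightarrow> ereal" where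
  "moreau_envelope r g x = (INF y. g y + ereal (r / 2 * (norm (y - x))\<^sup>2))"

definition fenchel_conjugate :: "('a::real_inner \<Rightarrow> ereal) \<Rightarrow> 'a \<Rightarrow> ereal" where
  "fenchel_conjugate f p = (SUP x. ereal (p \<bullet> x) - f x)"

definition strongly_convex :: "real \<Rightarrow> ('a::real_normed_vector \<Rightarrow> ereal) \<Rightarrow> bool" where
  "strongly_convex \<sigma> \<phi> \<longleftrightarrow>
     \<phi> \<in> Gamma0 \<and> \<sigma> > 0 \<and> convex_fun (\<lambda>x. \<phi> x - ereal (\<sigma> / 2 * (norm x)\<^sup>2))"

end

theory Submission
  imports Defs
begin

text \<open>
  Taking conjugates turns the Moreau envelope into the addition of a quadratic:
  \<open>(e\<^sub>r g)\<^sup>* = g\<^sup>* + \<parallel>\<cdot>\<parallel>\<^sup>2 / (2 r)\<close>. If \<open>f = e\<^sub>r g\<close>, then \<open>f\<^sup>* - \<parallel>\<cdot>\<parallel>\<^sup>2 / (2 r) = g\<^sup>*\<close> is convex.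
  Conversely, if \<open>h = f\<^sup>* - \<parallel>\<cdot>\<parallel>\<^sup>2 / (2 r)\<close> is convex, it belongs to \<open>\<Gamma>\<^sub>0\<close>, and \<open>g = h\<^sup>*\<close> has
  \<open>g\<^sup>* = h\<close> by the Fenchel--Moreau theorem. So \<open>e\<^sub>r g\<close> and \<open>f\<close> are two functions in \<open>\<Gamma>\<^sub>0\<close> with the
  same conjugate, hence equal. The Fenchel--Moreau theorem itself is proved by separating a point
  from the epigraph.
\<close>

section \<open>Lower semicontinuous functions and epigraphs\<close>

text \<open>Real thresholds suffice because a real lies strictly between any two distinct extended
  reals. Every later semicontinuity argument uses this form.\<close>

lemma lsc_fun_iff:
  fixes f :: "'a::topological_space \<Rightarrow> ereal"
  shows "lsc_fun f \<longleftrightarrow> (\<forall>x d. ereal d < f x \<longrightarrow> (\<forall>\<^sub>F y in at x. ereal d < f y))"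
proof
  assume "lsc_fun f"
  then show "\<forall>x d. ereal d < f x \<longrightarrow> (\<forall>\<^sub>F y in at x. ereal d < f y)"
    by (simp add: lsc_fun_def le_Liminf_iff)
next
  assume R: "\<forall>x d. ereal d < f x \<longrightarrow> (\<forall>\<^sub>F y in at x. ereal d < f y)"
  show "lsc_fun f"
    unfolding lsc_fun_def le_Liminf_iff
  proof (intro allI impI)
    fix x c assume "c < f x"
    then obtain d where d: "c < ereal d" "ereal d < f x"
      using ereal_dense2 by blast
    with R have "\<forall>\<^sub>F y in at x. ereal d < f y" by blast
    then show "\<forall>\<^sub>F y in at x. c < f y"
      by (rule eventually_mono) (use d in auto)
  qed
qed

lemma closed_ereal_epigraph:
  fixes f :: "'a::topological_space \<Rightarrow> ereal"
  assumes "lsc_fun f"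
  shows "closed {(x, t::real). f x \<le> ereal t}"
proof -
  have "open (- {(x, t::real). f x \<le> ereal t})"
  proof (subst open_subopen, intro ballI)
    fix z assume "z \<in> - {(x, t::real). f x \<le> ereal t}"
    then obtain x t where z: "z = (x, t)" and "ereal t < f x"
      by (cases z) auto
    \<comment> \<open>A level c strictly between t and f x leaves room to move both coordinates:
      near x the values of f stay above c, so a neighbourhood times \<open>{..<c}\<close> misses the
      epigraph.\<close>
    then obtain c where c: "t < c" "ereal c < f x"
      using ereal_dense2 by fastforce
    have "\<forall>\<^sub>F y in at x. ereal c < f y"
      using assms c by (simp add: lsc_fun_iff)
    then obtain U where U: "open U" "x \<in> U" "\<And>y. y \<in> U \<Longrightarrow> ereal c < f y"
      unfolding eventually_at_topological using c by (metis UNIV_I)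
    have "f y > ereal s" if "y \<in> U" "s < c" for y s
      using U(3)[OF that(1)] that(2) by (metis less_ereal.simps(1) order_less_trans)
    then have "U \<times> {..<c} \<subseteq> - {(x, t::real). f x \<le> ereal t}"
      by (auto dest!: leD)
    then show "\<exists>T. open T \<and> z \<in> T \<and> T \<subseteq> - {(x, t::real). f x \<le> ereal t}"
      using U c by (intro exI[of _ "U \<times> {..<c}"]) (auto simp: z open_Times)
  qed
  then show ?thesis by (simp add: closed_open)
qed

lemma convex_ereal_epigraph:
  fixes f :: "'a::real_vector \<Rightarrow> ereal"
  assumes "convex_fun f"
  shows "convex {(x, t::real). f x \<le> ereal t}"
proof (rule convexI)
  fix z w :: "'a \<times> real" and u v :: real
  assume z: "z \<in> {(x, t::real). f x \<le> ereal t}" and w: "w \<in> {(x, t::real). f x \<le> ereal t}"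
    and uv: "0 \<le> u" "0 \<le> v" "u + v = 1"
  have "f (u *\<^sub>R fst z + v *\<^sub>R fst w) \<le> ereal u * f (fst z) + ereal v * f (fst w)"
    using assms uv by (simp add: convex_fun_def)
  also have "\<dots> \<le> ereal u * ereal (snd z) + ereal v * ereal (snd w)"
    using z w uv by (intro add_mono ereal_mult_left_mono) auto
  finally show "u *\<^sub>R z + v *\<^sub>R w \<in> {(x, t::real). f x \<le> ereal t}"
    by (cases z; cases w) simp
qed

section \<open>The Fenchel conjugate\<close>

text \<open>Links conjugates with affine minorants: c is the negated intercept of a minorant with
  slope p. As c is real, the rearrangement is safe at infinite values of f, and later proofs need
  not handle the supremum.\<close>

lemma fenchel_conjugate_le_iff:
  "fenchel_conjugate f p \<le> ereal c \<longleftrightarrow> (\<forall>x. ereal (p \<bullet> x - c) \<le> f x)"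
proof -
  have "ereal (p \<bullet> x) - f x \<le> ereal c \<longleftrightarrow> ereal (p \<bullet> x - c) \<le> f x" for x
    by (cases "f x") auto
  then show ?thesis
    by (simp add: fenchel_conjugate_def SUP_le_iff)
qed

lemma fenchel_young:
  assumes "\<And>x. f x \<noteq> -\<infinity>"
  shows "ereal (p \<bullet> x) \<le> f x + fenchel_conjugate f p"
proof -
  have "ereal (p \<bullet> x) - f x \<le> fenchel_conjugate f p"
    unfolding fenchel_conjugate_def by (rule SUP_upper) simp
  then show ?thesis
    using assms[of x] by (cases "f x"; cases "fenchel_conjugate f p") auto
qed

lemma fenchel_conjugate_not_MInf:
  assumes "proper_fun f"
  shows "fenchel_conjugate f p \<noteq> -\<infinity>"
proof -
  obtain x where "f x \<noteq> \<infinity>" "f x \<noteq> -\<infinity>"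
    using assms by (auto simp: proper_fun_def)
  moreover have "ereal (p \<bullet> x) - f x \<le> fenchel_conjugate f p"
    unfolding fenchel_conjugate_def by (rule SUP_upper) simp
  ultimately show ?thesis by (cases "f x") auto
qed

text \<open>Convex combinations of affine minorants of f are again affine minorants, with combined
  slope and intercept.\<close>

lemma convex_fun_fenchel_conjugate:
  assumes "proper_fun f"
  shows "convex_fun (fenchel_conjugate f)"
  unfolding convex_fun_def
proof (intro allI impI)
  fix p q and u v :: real
  assume uv: "0 \<le> u" "0 \<le> v" "u + v = 1"
  let ?F = "fenchel_conjugate f"
  \<comment> \<open>Zero weights are split off because \<open>0 * \<infinity> = 0\<close>: an
    infinite conjugate value forces the right-hand side to be infinite only under a positive
    weight.\<close>
  show "?F (u *\<^sub>R p + v *\<^sub>R q) \<le> ereal u * ?F p + ereal v * ?F q"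
  proof (cases "u = 0 \<or> v = 0")
    case True
    then show ?thesis using uv by (auto simp flip: one_ereal_def zero_ereal_def)
  next
    case False
    then have pos: "u > 0" "v > 0" using uv by auto
    show ?thesis
    proof (cases "?F p = \<infinity> \<or> ?F q = \<infinity>")
      case True
      then show ?thesis
        using pos fenchel_conjugate_not_MInf[OF assms, of p]
          fenchel_conjugate_not_MInf[OF assms, of q]
        by (cases "?F p"; cases "?F q") auto
    next
      case False
      then obtain a b where ab: "?F p = ereal a" "?F q = ereal b"
        using fenchel_conjugate_not_MInf[OF assms] by (metis ereal_cases)
      have "ereal ((u *\<^sub>R p + v *\<^sub>R q) \<bullet> x - (u * a + v * b)) \<le> f x" for x
      proof -
        have p: "ereal (p \<bullet> x - a) \<le> f x" and q: "ereal (q \<bullet> x - b) \<le> f x"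
          using ab fenchel_conjugate_le_iff by (metis order_refl)+
        show ?thesis
        proof (cases "f x")
          case (real y)
          have "u * (p \<bullet> x - a) + v * (q \<bullet> x - b) \<le> u * y + v * y"
            using p q uv real by (intro add_mono mult_left_mono) auto
          also have "\<dots> = y" using uv by (metis distrib_right mult_1)
          finally show ?thesis using real by (simp add: inner_left_distrib algebra_simps)
        qed (use p in auto)
      qed
      then have "?F (u *\<^sub>R p + v *\<^sub>R q) \<le> ereal (u * a + v * b)"
        unfolding fenchel_conjugate_le_iff by blast
      then show ?thesis by (simp add: ab)
    qed
  qed
qed

text \<open>A single x whose term exceeds d at p still does so for nearby slopes, since that term is
  continuous in the slope or constantly infinite.\<close>

lemma lsc_fun_fenchel_conjugate: "lsc_fun (fenchel_conjugate f)"
  unfolding lsc_fun_iff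
proof (intro allI impI)
  fix p d assume "ereal d < fenchel_conjugate f p"
  then obtain x where x: "ereal d < ereal (p \<bullet> x) - f x"
    by (auto simp: fenchel_conjugate_def less_SUP_iff)
  have "\<forall>\<^sub>F q in at p. ereal d < ereal (q \<bullet> x) - f x"
  proof (cases "f x")
    case (real y)
    have "((\<lambda>q. q \<bullet> x) \<longlongrightarrow> p \<bullet> x) (at p)"
      by (intro tendsto_intros)
    moreover have "d + y < p \<bullet> x" using x real by simp
    ultimately have "\<forall>\<^sub>F q in at p. d + y < q \<bullet> x"
      by (rule order_tendstoD)
    then show ?thesis
      by (rule eventually_mono) (simp add: real)
  qed (use x in auto)
  then show "\<forall>\<^sub>F q in at p. ereal d < fenchel_conjugate f q"
    by (rule eventually_mono) (auto simp: fenchel_conjugate_def less_SUP_iff)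
qed

section \<open>Separation from the epigraph and affine minorants\<close>

lemma Gamma0_separation:
  fixes f :: "'a::euclidean_space \<Rightarrow> ereal"
  assumes "f \<in> Gamma0" "ereal \<alpha> < f x\<^sub>0"
  obtains p s b where "p \<bullet> x\<^sub>0 + s * \<alpha> < b" "s \<ge> 0"
    "\<And>x t. f x \<le> ereal t \<Longrightarrow> b < p \<bullet> x + s * t"
proof -
  let ?E = "{(x, t::real). f x \<le> ereal t}"
  have f: "proper_fun f" "convex_fun f" "lsc_fun f"
    using assms by (auto simp: Gamma0_def)
  have "(x\<^sub>0, \<alpha>) \<notin> ?E" using assms by auto
  then obtain a b where a: "a \<bullet> (x\<^sub>0, \<alpha>) < b" "\<And>z. z \<in> ?E \<Longrightarrow> b < a \<bullet> z"
    using separating_hyperplane_closed_point[of ?E "(x\<^sub>0, \<alpha>)"]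
      closed_ereal_epigraph[OF f(3)] convex_ereal_epigraph[OF f(2)] by blast
  obtain p s where ps: "a = (p, s)" by (cases a)
  have E: "b < p \<bullet> x + s * t" if "f x \<le> ereal t" for x t
    using a(2)[of "(x, t)"] that by (simp add: ps inner_Pair)
  obtain y c where y: "f y = ereal c"
    using f(1) by (metis ereal_cases proper_fun_def)
  have "s \<ge> 0"
  proof (rule ccontr)
    assume "\<not> s \<ge> 0"
    then have s: "s < 0" by simp
    \<comment> \<open>The epigraph is unbounded upwards: the maximum with c keeps (y, t) inside it,
      while a negative s pushes the functional down to b or below.\<close>
    define t where "t = max c ((b - p \<bullet> y) / s)"
    have "s * t \<le> s * ((b - p \<bullet> y) / s)"
      using s by (intro mult_left_mono_neg) (auto simp: t_def)
    then have "s * t \<le> b - p \<bullet> y" using s by simp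
    moreover have "b < p \<bullet> y + s * t" by (rule E) (simp add: y t_def)
    ultimately show False by simp
  qed
  then show thesis
    using that[of p s b] a(1) E by (auto simp: ps inner_Pair)
qed

lemma affine_minorant_of_separation:
  assumes "p \<bullet> x\<^sub>0 + s * \<alpha> < b" "s > 0" "\<And>x t. f x \<le> ereal t \<Longrightarrow> b < p \<bullet> x + s * t"
  obtains q c where "\<And>x. ereal (q \<bullet> x - c) \<le> f x" "\<alpha> < q \<bullet> x\<^sub>0 - c"
proof -
  \<comment> \<open>Solving p \<bullet> x + s t = b for t turns the non-vertical hyperplane into the
    graph of an affine function.\<close>
  define q c where "q = (- 1 / s) *\<^sub>R p" and "c = - b / s"
  have aff: "q \<bullet> x - c = (b - p \<bullet> x) / s" for x
    by (simp add: q_def c_def diff_divide_distrib)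
  have "ereal (q \<bullet> x - c) \<le> f x" for x
  proof (rule ereal_le_real)
    fix t assume "f x \<le> ereal t"
    from assms(3)[OF this] show "ereal (q \<bullet> x - c) \<le> ereal t"
      unfolding aff using assms(2) by (simp add: divide_le_eq algebra_simps)
  qed
  moreover have "\<alpha> < q \<bullet> x\<^sub>0 - c"
    unfolding aff using assms(1,2) by (simp add: less_divide_eq algebra_simps)
  ultimately show thesis by (rule that)
qed

text \<open>Above a point y of the domain, the hyperplane separates (y, d - 1) from (y, d). These
  differ only in height, so it cannot be vertical.\<close>

lemma Gamma0_affine_minorant:
  fixes f :: "'a::euclidean_space \<Rightarrow> ereal"
  assumes "f \<in> Gamma0"
  obtains q c where "\<And>x. ereal (q \<bullet> x - c) \<le> f x"
proof -
  obtain y d where y: "f y = ereal d"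
    using assms by (metis (mono_tags, lifting) Gamma0_def ereal_cases mem_Collect_eq proper_fun_def)
  obtain p s b where psb: "p \<bullet> y + s * (d - 1) < b" "s \<ge> 0"
    "\<And>x t. f x \<le> ereal t \<Longrightarrow> b < p \<bullet> x + s * t"
    using Gamma0_separation[OF assms, of "d - 1" y] by (auto simp: y)
  have "b < p \<bullet> y + s * d" by (rule psb(3)) (simp add: y)
  with psb(1,2) have "s > 0"
    by (cases "s = 0") auto
  from affine_minorant_of_separation[OF psb(1) this psb(3)] that show thesis
    by blast
qed

text \<open>Supplies the hard inequality of \<open>fenchel_moreau\<close>. Here f may be infinite at
  \<open>x\<^sub>0\<close>, so the separating hyperplane may be vertical.\<close>

lemma Gamma0_strict_affine_minorant:
  fixes f :: "'a::euclidean_space \<Rightarrow> ereal"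
  assumes "f \<in> Gamma0" "ereal \<alpha> < f x\<^sub>0"
  obtains q c where "\<And>x. ereal (q \<bullet> x - c) \<le> f x" "\<alpha> < q \<bullet> x\<^sub>0 - c"
proof -
  obtain p s b where psb: "p \<bullet> x\<^sub>0 + s * \<alpha> < b" "s \<ge> 0"
    "\<And>x t. f x \<le> ereal t \<Longrightarrow> b < p \<bullet> x + s * t"
    using Gamma0_separation[OF assms] by blast
  show thesis
  proof (cases "s = 0")
    case False
    with psb(2) have "s > 0" by simp
    from affine_minorant_of_separation[OF psb(1) this psb(3)] that show thesis
      by blast
  next
    case True
    \<comment> \<open>The hyperplane is vertical: \<open>b - \<langle>p, x\<rangle>\<close> is negative on the domain of \<open>f\<close> and positive
      at \<open>x\<^sub>0\<close>, so a large multiple of it may be added to any affine minorant.\<close>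
    obtain q c where qc: "\<And>x. ereal (q \<bullet> x - c) \<le> f x"
      using Gamma0_affine_minorant[OF assms(1)] by blast
    define \<delta> where "\<delta> = b - p \<bullet> x\<^sub>0"
    \<comment> \<open>This k makes k \<delta> exceed the gap between \<alpha> and the minorant's
      value at \<open>x\<^sub>0\<close> by exactly \<delta>.\<close>
    define k where "k = \<bar>\<alpha> - (q \<bullet> x\<^sub>0 - c)\<bar> / \<delta> + 1"
    have \<delta>: "\<delta> > 0" using psb(1) True by (simp add: \<delta>_def)
    then have k: "k \<ge> 0" by (simp add: k_def)
    have aff: "(q - k *\<^sub>R p) \<bullet> x - (c - k * b) = (q \<bullet> x - c) + k * (b - p \<bullet> x)" for x
      by (simp add: inner_diff_left algebra_simps)
    have "ereal ((q - k *\<^sub>R p) \<bullet> x - (c - k * b)) \<le> f x" for x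
    proof (rule ereal_le_real)
      fix t assume t: "f x \<le> ereal t"
      have "b < p \<bullet> x" using psb(3)[OF t] True by simp
      then have "k * (b - p \<bullet> x) \<le> 0"
        using k by (simp add: mult_nonneg_nonpos)
      moreover have "q \<bullet> x - c \<le> t" using order_trans[OF qc t] by simp
      ultimately show "ereal ((q - k *\<^sub>R p) \<bullet> x - (c - k * b)) \<le> ereal t"
        unfolding aff by simp
    qed
    moreover have "k * \<delta> = \<bar>\<alpha> - (q \<bullet> x\<^sub>0 - c)\<bar> + \<delta>"
      using \<delta> by (simp add: k_def field_simps)
    then have "\<alpha> < (q - k *\<^sub>R p) \<bullet> x\<^sub>0 - (c - k * b)"
      unfolding aff \<delta>_def[symmetric] using \<delta> by linarith
    ultimately show thesis by (rule that)
  qed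
qed

text \<open>The slope of an affine minorant of f is a point where the conjugate is not \<infinity>,
  which gives properness.\<close>

lemma fenchel_conjugate_Gamma0:
  fixes f :: "'a::euclidean_space \<Rightarrow> ereal"
  assumes "f \<in> Gamma0"
  shows "fenchel_conjugate f \<in> Gamma0"
proof -
  have f: "proper_fun f" using assms by (simp add: Gamma0_def)
  obtain q c where "\<And>x. ereal (q \<bullet> x - c) \<le> f x"
    using Gamma0_affine_minorant[OF assms] by blast
  then have "fenchel_conjugate f q \<le> ereal c" by (simp add: fenchel_conjugate_le_iff)
  then have "fenchel_conjugate f q \<noteq> \<infinity>" by auto
  then have "proper_fun (fenchel_conjugate f)"
    using fenchel_conjugate_not_MInf[OF f] by (auto simp: proper_fun_def)
  then show ?thesis
    by (simp add: Gamma0_def convex_fun_fenchel_conjugate[OF f] lsc_fun_fenchel_conjugate)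
qed

theorem fenchel_moreau:
  fixes f :: "'a::euclidean_space \<Rightarrow> ereal"
  assumes "f \<in> Gamma0"
  shows "fenchel_conjugate (fenchel_conjugate f) = f"
proof (rule ext, rule antisym)
  fix x
  have f: "proper_fun f" using assms by (simp add: Gamma0_def)
  show "fenchel_conjugate (fenchel_conjugate f) x \<le> f x"
    unfolding fenchel_conjugate_def[of "fenchel_conjugate f"]
  proof (rule SUP_least)
    fix p
    have "ereal (p \<bullet> x) \<le> f x + fenchel_conjugate f p"
      by (rule fenchel_young) (use f in \<open>simp add: proper_fun_def\<close>)
    then show "ereal (x \<bullet> p) - fenchel_conjugate f p \<le> f x"
      using fenchel_conjugate_not_MInf[OF f, of p]
      by (cases "f x"; cases "fenchel_conjugate f p") (auto simp: inner_commute)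
  qed
  show "f x \<le> fenchel_conjugate (fenchel_conjugate f) x"
  proof (rule ccontr)
    assume "\<not> ?thesis"
    then obtain \<alpha> where \<alpha>: "fenchel_conjugate (fenchel_conjugate f) x < ereal \<alpha>" "ereal \<alpha> < f x"
      using ereal_dense2 by (metis not_le)
    obtain q c where qc: "\<And>x. ereal (q \<bullet> x - c) \<le> f x" "\<alpha> < q \<bullet> x - c"
      using Gamma0_strict_affine_minorant[OF assms \<alpha>(2)] by blast
    have "fenchel_conjugate f q \<le> ereal c"
      using qc(1) by (simp add: fenchel_conjugate_le_iff)
    \<comment> \<open>The upper bound \<alpha> on the biconjugate at x says that x and \<alpha>
      define an affine minorant of the conjugate; it is evaluated at q.\<close>
    moreover have "ereal (x \<bullet> q - \<alpha>) \<le> fenchel_conjugate f q"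
      using less_imp_le[OF \<alpha>(1)] by (simp only: fenchel_conjugate_le_iff)
    ultimately have "ereal (x \<bullet> q - \<alpha>) \<le> ereal c" by (rule order_trans[rotated])
    with qc(2) show False by (simp add: inner_commute)
  qed
qed

section \<open>The Moreau envelope\<close>

text \<open>Completing the square: the gap is a multiple of the squared norm of r z - p.\<close>

lemma quadratic_ge_linear:
  fixes p z :: "'a::real_inner"
  assumes "r > 0"
  shows "p \<bullet> z - (norm p)\<^sup>2 / (2 * r) \<le> r / 2 * (norm z)\<^sup>2"
proof -
  have "0 \<le> (norm (r *\<^sub>R z - p))\<^sup>2 / (2 * r)" using assms by simp
  also have "\<dots> = r / 2 * (norm z)\<^sup>2 + (norm p)\<^sup>2 / (2 * r) - p \<bullet> z"
    using assms
    by (simp add: power2_norm_eq_inner inner_diff_left inner_diff_right inner_commute field_simps)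
  finally show ?thesis by simp
qed

lemma le_moreau_envelope_iff:
  "ereal c \<le> moreau_envelope r g x \<longleftrightarrow> (\<forall>y. ereal (c - r / 2 * (norm (y - x))\<^sup>2) \<le> g y)"
proof -
  have "ereal c \<le> g y + ereal (r / 2 * (norm (y - x))\<^sup>2)
      \<longleftrightarrow> ereal (c - r / 2 * (norm (y - x))\<^sup>2) \<le> g y" for y
    by (cases "g y") auto
  then show ?thesis by (simp add: moreau_envelope_def le_INF_iff)
qed

lemma ereal_eq_by_upper_bounds:
  fixes a b :: ereal
  assumes "\<And>c. a \<le> ereal c \<longleftrightarrow> b \<le> ereal c"
  shows "a = b"
  by (rule antisym; rule ereal_le_real) (simp_all add: assms)

text \<open>Upper bounds on the conjugate unfold to a condition on all pairs x, y. For fixed y, the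
  best x contributes the quadratic in p, and a condition on the conjugate of g remains.\<close>

lemma fenchel_conjugate_moreau_envelope:
  fixes g :: "'a::real_inner \<Rightarrow> ereal"
  assumes "r > 0"
  shows "fenchel_conjugate (moreau_envelope r g) p
       = fenchel_conjugate g p + ereal ((norm p)\<^sup>2 / (2 * r))"
proof (rule ereal_eq_by_upper_bounds)
  fix c
  let ?n = "(norm p)\<^sup>2 / (2 * r)"
  have eq: "(\<forall>x. ereal (p \<bullet> x - c - r / 2 * (norm (y - x))\<^sup>2) \<le> g y)
      \<longleftrightarrow> ereal (p \<bullet> y - (c - ?n)) \<le> g y" for y
  proof
    assume A: "\<forall>x. ereal (p \<bullet> x - c - r / 2 * (norm (y - x))\<^sup>2) \<le> g y"
    \<comment> \<open>The supremum over \<open>x\<close> is attained at \<open>x = y + p / r\<close>.\<close>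
    have "p \<bullet> (y + p /\<^sub>R r) - c - r / 2 * (norm (y - (y + p /\<^sub>R r)))\<^sup>2 = p \<bullet> y - (c - ?n)"
      using assms
      by (simp add: inner_add_right power_mult_distrib power2_norm_eq_inner[symmetric]
          field_simps power2_eq_square)
    then show "ereal (p \<bullet> y - (c - ?n)) \<le> g y"
      using A by metis
  next
    assume A: "ereal (p \<bullet> y - (c - ?n)) \<le> g y"
    show "\<forall>x. ereal (p \<bullet> x - c - r / 2 * (norm (y - x))\<^sup>2) \<le> g y"
    proof
      fix x
      have "p \<bullet> x - c - r / 2 * (norm (y - x))\<^sup>2 \<le> p \<bullet> y - (c - ?n)"
        using quadratic_ge_linear[OF assms, of p "x - y"]
        by (simp add: inner_diff_right norm_minus_commute)
      with A show "ereal (p \<bullet> x - c - r / 2 * (norm (y - x))\<^sup>2) \<le> g y"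
        by (meson ereal_less_eq(3) order_trans)
    qed
  qed
  \<comment> \<open>The quantifiers over x and y are exchanged here, so that \<open>eq\<close>
    applies for each y.\<close>
  have "fenchel_conjugate (moreau_envelope r g) p \<le> ereal c
      \<longleftrightarrow> (\<forall>y. ereal (p \<bullet> y - (c - ?n)) \<le> g y)"
    unfolding fenchel_conjugate_le_iff le_moreau_envelope_iff eq[symmetric] by blast
  also have "\<dots> \<longleftrightarrow> fenchel_conjugate g p \<le> ereal (c - ?n)"
    by (simp only: fenchel_conjugate_le_iff)
  also have "\<dots> \<longleftrightarrow> fenchel_conjugate g p + ereal ?n \<le> ereal c"
    by (cases "fenchel_conjugate g p") auto
  finally show "fenchel_conjugate (moreau_envelope r g) p \<le> ereal c
      \<longleftrightarrow> fenchel_conjugate g p + ereal ?n \<le> ereal c" .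
qed

lemma moreau_envelope_finite:
  fixes g :: "'a::euclidean_space \<Rightarrow> ereal"
  assumes "g \<in> Gamma0" "r > 0"
  shows "\<bar>moreau_envelope r g x\<bar> \<noteq> \<infinity>"
proof -
  obtain y d where y: "g y = ereal d"
    using assms by (metis (mono_tags, lifting) Gamma0_def ereal_cases mem_Collect_eq proper_fun_def)
  have "moreau_envelope r g x \<le> g y + ereal (r / 2 * (norm (y - x))\<^sup>2)"
    unfolding moreau_envelope_def by (rule INF_lower) simp
  then have "moreau_envelope r g x \<noteq> \<infinity>" by (auto simp: y)
  moreover
  obtain q c where qc: "\<And>x. ereal (q \<bullet> x - c) \<le> g x"
    using Gamma0_affine_minorant[OF assms(1)] by blast
  \<comment> \<open>The bound is the value at x of the Moreau envelope of the affine minorant of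
    g.\<close>
  have "ereal (q \<bullet> x - c - (norm q)\<^sup>2 / (2 * r)) \<le> moreau_envelope r g x"
    unfolding le_moreau_envelope_iff
  proof
    fix z
    have "q \<bullet> x - c - (norm q)\<^sup>2 / (2 * r) - r / 2 * (norm (z - x))\<^sup>2 \<le> q \<bullet> z - c"
      using quadratic_ge_linear[OF assms(2), of q "x - z"]
      by (simp add: inner_diff_right norm_minus_commute)
    with qc[of z]
    show "ereal (q \<bullet> x - c - (norm q)\<^sup>2 / (2 * r) - r / 2 * (norm (z - x))\<^sup>2) \<le> g z"
      by (meson ereal_less_eq(3) order_trans)
  qed
  ultimately show ?thesis by auto
qed

text \<open>The two sides differ by u v times the squared distance of x and y.\<close>

lemma convex_norm_square:
  fixes x y :: "'a::real_inner"
  assumes "0 \<le> u" "0 \<le> v" "u + v = 1"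
  shows "(norm (u *\<^sub>R x + v *\<^sub>R y))\<^sup>2 \<le> u * (norm x)\<^sup>2 + v * (norm y)\<^sup>2"
proof -
  have v: "v = 1 - u" using assms by simp
  have "u * (norm x)\<^sup>2 + v * (norm y)\<^sup>2 - (norm (u *\<^sub>R x + v *\<^sub>R y))\<^sup>2 = u * v * (norm (x - y))\<^sup>2"
    unfolding v power2_norm_eq_inner
    by (simp add: inner_add_left inner_add_right inner_diff_left inner_diff_right
        inner_commute algebra_simps)
  moreover have "0 \<le> u * v * (norm (x - y))\<^sup>2" using assms by simp
  ultimately show ?thesis by linarith
qed

text \<open>Strict bounds yield points x' and y' beating a and b, with no need for the infima to be
  attained. Their convex combination is then a competitor in the infimum at the combined
  point.\<close>

lemma moreau_envelope_convex_combination: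
  fixes g :: "'a::real_inner \<Rightarrow> ereal"
  assumes g: "convex_fun g" and r: "r > 0" and uv: "0 \<le> u" "0 \<le> v" "u + v = 1"
    and x: "moreau_envelope r g x < ereal a" and y: "moreau_envelope r g y < ereal b"
  shows "moreau_envelope r g (u *\<^sub>R x + v *\<^sub>R y) \<le> ereal (u * a + v * b)"
proof -
  let ?q = "\<lambda>z. r / 2 * (norm z)\<^sup>2"
  obtain x' y' where x': "g x' + ereal (?q (x' - x)) < ereal a"
    and y': "g y' + ereal (?q (y' - y)) < ereal b"
    using x y unfolding moreau_envelope_def INF_less_iff by blast
  have gx: "g x' \<le> ereal (a - ?q (x' - x))" and gy: "g y' \<le> ereal (b - ?q (y' - y))"
    using x' y' by (cases "g x'"; cases "g y'"; simp)+
  have "u *\<^sub>R x' + v *\<^sub>R y' - (u *\<^sub>R x + v *\<^sub>R y) = u *\<^sub>R (x' - x) + v *\<^sub>R (y' - y)"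
    by (simp add: algebra_simps)
  then have "(norm (u *\<^sub>R x' + v *\<^sub>R y' - (u *\<^sub>R x + v *\<^sub>R y)))\<^sup>2
      \<le> u * (norm (x' - x))\<^sup>2 + v * (norm (y' - y))\<^sup>2"
    using convex_norm_square[OF uv] by metis
  from mult_left_mono[OF this, of "r / 2"] r
  have q: "?q (u *\<^sub>R x' + v *\<^sub>R y' - (u *\<^sub>R x + v *\<^sub>R y)) \<le> u * ?q (x' - x) + v * ?q (y' - y)"
    by (simp add: algebra_simps)
  have "g (u *\<^sub>R x' + v *\<^sub>R y') \<le> ereal u * g x' + ereal v * g y'"
    using g uv by (simp add: convex_fun_def)
  also have "\<dots> \<le> ereal u * ereal (a - ?q (x' - x)) + ereal v * ereal (b - ?q (y' - y))"
    using gx gy uv by (intro add_mono ereal_mult_left_mono) auto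
  finally have "g (u *\<^sub>R x' + v *\<^sub>R y') \<le> ereal (u * (a - ?q (x' - x)) + v * (b - ?q (y' - y)))"
    by simp
  from add_mono[OF this, of "ereal (?q (u *\<^sub>R x' + v *\<^sub>R y' - (u *\<^sub>R x + v *\<^sub>R y)))"
      "ereal (u * ?q (x' - x) + v * ?q (y' - y))"] q
  have "g (u *\<^sub>R x' + v *\<^sub>R y') + ereal (?q (u *\<^sub>R x' + v *\<^sub>R y' - (u *\<^sub>R x + v *\<^sub>R y)))
      \<le> ereal (u * a + v * b)"
    by (simp add: algebra_simps)
  then show ?thesis
    unfolding moreau_envelope_def by (rule INF_lower2[OF UNIV_I])
qed

text \<open>The envelope is finite everywhere, and a finite convex function on a Euclidean space is
  continuous, hence lower semicontinuous.\<close>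

lemma moreau_envelope_Gamma0:
  fixes g :: "'a::euclidean_space \<Rightarrow> ereal"
  assumes "g \<in> Gamma0" "r > 0"
  shows "moreau_envelope r g \<in> Gamma0"
proof -
  define e where "e x = real_of_ereal (moreau_envelope r g x)" for x
  have e: "moreau_envelope r g = (\<lambda>x. ereal (e x))"
    using moreau_envelope_finite[OF assms] by (simp add: e_def ereal_real')
  have conv: "e (u *\<^sub>R x + v *\<^sub>R y) \<le> u * e x + v * e y"
    if uv: "0 \<le> u" "0 \<le> v" "u + v = 1" for u v x y
  \<comment> \<open>The slack \<epsilon> turns the values of e into the strict upper bounds that the
    previous lemma asks for; since u + v = 1, it reappears once.\<close>
  proof (rule field_le_epsilon)
    fix \<epsilon> :: real assume "\<epsilon> > 0"
    then have "moreau_envelope r g (u *\<^sub>R x + v *\<^sub>R y) \<le> ereal (u * (e x + \<epsilon>) + v * (e y + \<epsilon>))"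
      using assms uv by (intro moreau_envelope_convex_combination) (auto simp: e Gamma0_def)
    moreover have "u * (e x + \<epsilon>) + v * (e y + \<epsilon>) = u * e x + v * e y + (u + v) * \<epsilon>"
      by (simp add: algebra_simps)
    ultimately show "e (u *\<^sub>R x + v *\<^sub>R y) \<le> u * e x + v * e y + \<epsilon>"
      by (simp add: e uv)
  qed
  then have "convex_on UNIV e"
    unfolding convex_on_def by auto
  then have cont: "continuous_on UNIV e"
    by (intro convex_on_continuous) auto
  have "lsc_fun (\<lambda>x. ereal (e x))"
    unfolding lsc_fun_iff
  proof (intro allI impI)
    fix x d assume "ereal d < ereal (e x)"
    moreover have "(e \<longlongrightarrow> e x) (at x)"
      using cont by (simp add: continuous_on_def)
    ultimately show "\<forall>\<^sub>F y in at x. ereal d < ereal (e y)"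
      by (simp add: order_tendstoD)
  qed
  moreover have "convex_fun (\<lambda>x. ereal (e x))"
    using conv by (simp add: convex_fun_def)
  moreover have "proper_fun (\<lambda>x. ereal (e x))"
    by (simp add: proper_fun_def)
  ultimately show ?thesis by (simp add: Gamma0_def e)
qed

section \<open>Envelopes and strong convexity of the conjugate\<close>

lemma lsc_fun_diff_continuous:
  fixes f :: "'a::topological_space \<Rightarrow> ereal" and q :: "'a \<Rightarrow> real"
  assumes "lsc_fun f" "\<And>x. (q \<longlongrightarrow> q x) (at x)"
  shows "lsc_fun (\<lambda>x. f x - ereal (q x))"
  unfolding lsc_fun_iff
proof (intro allI impI)
  fix x d assume "ereal d < f x - ereal (q x)"
  then have "ereal (d + q x) < f x" by (cases "f x") auto
  \<comment> \<open>The level c divides the slack: f stays above c and q below c - d near x, so the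
    difference stays above d.\<close>
  then obtain c where c: "d + q x < c" "ereal c < f x"
    using ereal_dense2 by fastforce
  have "\<forall>\<^sub>F y in at x. ereal c < f y"
    using assms(1) c(2) by (simp add: lsc_fun_iff)
  moreover have "q x < c - d" using c(1) by simp
  with assms(2) have "\<forall>\<^sub>F y in at x. q y < c - d"
    by (rule order_tendstoD)
  ultimately show "\<forall>\<^sub>F y in at x. ereal d < f y - ereal (q y)"
  proof eventually_elim
    case (elim y)
    then show ?case by (cases "f y") auto
  qed
qed

theorem theorem3p8:
  fixes f :: "real ^ 'n \<Rightarrow> ereal" and r :: real
  assumes "f \<in> Gamma0" and "r > 0"
  shows "(\<exists>g \<in> Gamma0. f = moreau_envelope r g) \<longleftrightarrow>
         strongly_convex (1 / r) (fenchel_conjugate f)"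
proof
  assume "\<exists>g \<in> Gamma0. f = moreau_envelope r g"
  then obtain g where g: "g \<in> Gamma0" "f = moreau_envelope r g" by blast
  \<comment> \<open>The quadratic is real-valued, so it cancels even where the conjugate of g is
    infinite.\<close>
  have "fenchel_conjugate f x - ereal (1 / r / 2 * (norm x)\<^sup>2) = fenchel_conjugate g x" for x
    unfolding g(2) fenchel_conjugate_moreau_envelope[OF assms(2)]
    by (cases "fenchel_conjugate g x") (auto simp: field_simps)
  then have "convex_fun (\<lambda>x. fenchel_conjugate f x - ereal (1 / r / 2 * (norm x)\<^sup>2))"
    using g(1) by (simp add: convex_fun_fenchel_conjugate Gamma0_def)
  then show "strongly_convex (1 / r) (fenchel_conjugate f)"
    using assms by (simp add: strongly_convex_def fenchel_conjugate_Gamma0)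
next
  assume sc: "strongly_convex (1 / r) (fenchel_conjugate f)"
  define h where "h x = fenchel_conjugate f x - ereal (1 / r / 2 * (norm x)\<^sup>2)" for x
  define g where "g = fenchel_conjugate h"
  have F: "proper_fun (fenchel_conjugate f)" "lsc_fun (fenchel_conjugate f)"
    using sc by (auto simp: strongly_convex_def Gamma0_def)
  have "convex_fun h"
    using sc by (simp add: strongly_convex_def h_def[abs_def])
  moreover have "lsc_fun h"
    unfolding h_def[abs_def] by (intro lsc_fun_diff_continuous F tendsto_intros)
  \<comment> \<open>Subtracting a real number preserves infinite values, so properness passes from
    the conjugate of f to h.\<close>
  moreover have "h x = -\<infinity> \<longleftrightarrow> fenchel_conjugate f x = -\<infinity>"
    "h x = \<infinity> \<longleftrightarrow> fenchel_conjugate f x = \<infinity>" for x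
    by (cases "fenchel_conjugate f x"; simp add: h_def)+
  then have "proper_fun h" using F(1) by (simp add: proper_fun_def)
  ultimately have h: "h \<in> Gamma0" by (simp add: Gamma0_def)
  then have g: "g \<in> Gamma0" by (simp add: g_def fenchel_conjugate_Gamma0)
  \<comment> \<open>The conjugate of g is h by biconjugation, so conjugating the envelope adds back
    the quadratic removed in h.\<close>
  have "fenchel_conjugate (moreau_envelope r g) x = fenchel_conjugate f x" for x
    unfolding fenchel_conjugate_moreau_envelope[OF assms(2)] g_def fenchel_moreau[OF h]
    by (cases "fenchel_conjugate f x") (auto simp: h_def field_simps)
  then have "fenchel_conjugate (moreau_envelope r g) = fenchel_conjugate f" by (rule ext)
  then have "moreau_envelope r g = f"
    using fenchel_moreau[OF assms(1)] fenchel_moreau[OF moreau_envelope_Gamma0[OF g assms(2)]]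
    by simp
  with g show "\<exists>g \<in> Gamma0. f = moreau_envelope r g" by blast
qed

end
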